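(* Let $Q,R,S\in\mathfrak{P}$ with $Q\cap R=\emptyset$ and $Q\cap S=\emptyset$. Then (i) $Q+R\sqsubseteq Q+S$ implies $R\sqsubseteq S$; (ii) $Q+R\sqsubseteq_G Q+S$ implies $R\sqsubseteq_G S$.
   Context: $\mathfrak{P}$ is the class of finite nonempty posets and $\mathfrak{P}_r$ a fixed system of representatives of its isomorphism classes (isomorphic posets are identified with their representative). $\mathcal{H}(P,Q)$ is the set of order-preserving maps (homomorphisms) $P\to Q$. For disjoint posets $A,B$, $A+B$ is their direct sum (disjoint union, no comparabilities between $A$ and $B$). For $A\subseteq P$ and $x\in A$, $\gamma_A(x)$ is the set of $y\in A$ such that there are $x=z_0,z_1,\dots,z_L=y$ in $A$ ($L\ge 0$) with $z_{\ell-1}<z_\ell$ or $z_{\ell-1}>z_\ell$ for every $\ell$. For a map $\xi$ from the carrier of a poset $P$ to a set and $x\in P$, $G_\xi(x):=\gamma_{\xi^{-1}(\xi(x))}(x)$. For $R,S\in\mathfrak{P}$, a Hom-scheme from $R$ to $S$ is a family $\rho=(\rho_P)_{P\in\mathfrak{P}_r}$ of maps $\rho_P:\mathcal{H}(P,R)\to\mathcal{H}(P,S)$; it is strong if every $\rho_P$ is injective, and a G-scheme if $G_{\rho_P(\xi)}(x)=G_\xi(x)$ for all $P\in\mathfrak{P}_r$, $\xi\in\mathcal{H}(P,R)$, $x\in P$. $R\sqsubseteq S$ means that a strong Hom-scheme from $R$ to $S$ exists; $R\sqsubseteq_G S$ means that a strong G-scheme from $R$ to $S$ exists. *)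

theory Defs
  imports "HOL-Library.FuncSet"
begin

(* A poset is its reflexive order relation "(x, y) : P iff x <= y in P"; by reflexivity its
   carrier is Field P, so the carrier need not be recorded separately. *)
definition fin_poset :: "'a rel \<Rightarrow> bool" where
  "fin_poset P \<longleftrightarrow> Partial_order P \<and> finite (Field P) \<and> Field P \<noteq> {}"

(* Homomorphisms are extensional functions (undefined outside the carrier), so that equality of
   HOL functions is equality of maps. *)
definition Hom :: "'a rel \<Rightarrow> 'b rel \<Rightarrow> ('a \<Rightarrow> 'b) set" where
  "Hom P Q = {f \<in> Field P \<rightarrow>\<^sub>E Field Q. monotone_on (Field P) (\<lambda>x y. (x, y) \<in> P) (\<lambda>x y. (x, y) \<in> Q) f}"

definition poset_iso :: "'a rel \<Rightarrow> 'b rel \<Rightarrow> bool" where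
  "poset_iso P Q \<longleftrightarrow>
    (\<exists>f. bij_betw f (Field P) (Field Q) \<and>
      (\<forall>x \<in> Field P. \<forall>y \<in> Field P. (x, y) \<in> P \<longleftrightarrow> (f x, f y) \<in> Q))"

(* Only meant for posets with disjoint carriers. *)
definition direct_sum :: "'a rel \<Rightarrow> 'a rel \<Rightarrow> 'a rel"  (infixl \<open>\<oplus>\<close> 65) where
  "A \<oplus> B = A \<union> B"

(* gamma P A x is meant for A a subset of Field P and x in A. *)
definition gamma :: "'a rel \<Rightarrow> 'a set \<Rightarrow> 'a \<Rightarrow> 'a set" where
  "gamma P A x = {y. (x, y) \<in> {(u, v). u \<in> A \<and> v \<in> A \<and> u \<noteq> v \<and> ((u, v) \<in> P \<or> (v, u) \<in> P)}\<^sup>*}"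

definition G :: "'a rel \<Rightarrow> ('a \<Rightarrow> 'b) \<Rightarrow> 'a \<Rightarrow> 'a set" where
  "G P \<xi> x = gamma P {y \<in> Field P. \<xi> y = \<xi> x} x"

(* The representatives live on finite subsets of nat, which realise every finite poset
   up to isomorphism (see rep_system_covers below). *)
definition rep_system :: "nat rel set \<Rightarrow> bool" where
  "rep_system \<RR> \<longleftrightarrow>
    (\<forall>P \<in> \<RR>. fin_poset P) \<and> (\<forall>P :: nat rel. fin_poset P \<longrightarrow> (\<exists>!P'. P' \<in> \<RR> \<and> poset_iso P P'))"

type_synonym ('a, 'b) scheme = "nat rel \<Rightarrow> (nat \<Rightarrow> 'a) \<Rightarrow> (nat \<Rightarrow> 'b)"

definition hom_scheme :: "nat rel set \<Rightarrow> 'a rel \<Rightarrow> 'b rel \<Rightarrow> ('a, 'b) scheme \<Rightarrow> bool" where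
  "hom_scheme \<RR> R S \<rho> \<longleftrightarrow> (\<forall>P \<in> \<RR>. \<rho> P \<in> Hom P R \<rightarrow> Hom P S)"

definition strong_scheme :: "nat rel set \<Rightarrow> 'a rel \<Rightarrow> 'b rel \<Rightarrow> ('a, 'b) scheme \<Rightarrow> bool" where
  "strong_scheme \<RR> R S \<rho> \<longleftrightarrow> hom_scheme \<RR> R S \<rho> \<and> (\<forall>P \<in> \<RR>. inj_on (\<rho> P) (Hom P R))"

definition G_scheme :: "nat rel set \<Rightarrow> 'a rel \<Rightarrow> 'b rel \<Rightarrow> ('a, 'b) scheme \<Rightarrow> bool" where
  "G_scheme \<RR> R S \<rho> \<longleftrightarrow> hom_scheme \<RR> R S \<rho> \<and>
    (\<forall>P \<in> \<RR>. \<forall>\<xi> \<in> Hom P R. \<forall>x \<in> Field P. G P (\<rho> P \<xi>) x = G P \<xi> x)"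

definition hom_le :: "nat rel set \<Rightarrow> 'a rel \<Rightarrow> 'b rel \<Rightarrow> bool" where
  "hom_le \<RR> R S \<longleftrightarrow> (\<exists>\<rho>. strong_scheme \<RR> R S \<rho>)"

definition hom_le_G :: "nat rel set \<Rightarrow> 'a rel \<Rightarrow> 'b rel \<Rightarrow> bool" where
  "hom_le_G \<RR> R S \<longleftrightarrow> (\<exists>\<rho>. strong_scheme \<RR> R S \<rho> \<and> G_scheme \<RR> R S \<rho>)"

lemma poset_iso_refl: "poset_iso P P"
  unfolding poset_iso_def by (rule exI[of _ id]) auto

lemma poset_iso_sym:
  assumes "poset_iso P Q"
  shows "poset_iso Q P"
proof -
  obtain f where f: "bij_betw f (Field P) (Field Q)"
    and m: "\<And>x y. x \<in> Field P \<Longrightarrow> y \<in> Field P \<Longrightarrow> (x, y) \<in> P \<longleftrightarrow> (f x, f y) \<in> Q"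
    using assms unfolding poset_iso_def by blast
  let ?g = "inv_into (Field P) f"
  have g: "bij_betw ?g (Field Q) (Field P)"
    using f by (rule bij_betw_inv_into)
  have "(x, y) \<in> Q \<longleftrightarrow> (?g x, ?g y) \<in> P" if "x \<in> Field Q" "y \<in> Field Q" for x y
    using m[of "?g x" "?g y"] that bij_betwE[OF g] bij_betw_inv_into_right[OF f] by simp
  with g show ?thesis unfolding poset_iso_def by blast
qed

lemma poset_iso_trans:
  assumes "poset_iso P Q" "poset_iso Q T"
  shows "poset_iso P T"
proof -
  obtain f where f: "bij_betw f (Field P) (Field Q)"
    and m: "\<And>x y. x \<in> Field P \<Longrightarrow> y \<in> Field P \<Longrightarrow> (x, y) \<in> P \<longleftrightarrow> (f x, f y) \<in> Q"
    using assms(1) unfolding poset_iso_def by blast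
  obtain g where g: "bij_betw g (Field Q) (Field T)"
    and n: "\<And>x y. x \<in> Field Q \<Longrightarrow> y \<in> Field Q \<Longrightarrow> (x, y) \<in> Q \<longleftrightarrow> (g x, g y) \<in> T"
    using assms(2) unfolding poset_iso_def by blast
  have "bij_betw (g \<circ> f) (Field P) (Field T)"
    using f g by (rule bij_betw_trans)
  moreover have "(x, y) \<in> P \<longleftrightarrow> ((g \<circ> f) x, (g \<circ> f) y) \<in> T"
    if "x \<in> Field P" "y \<in> Field P" for x y
    using m n that bij_betwE[OF f] by simp
  ultimately show ?thesis unfolding poset_iso_def by blast
qed

lemma ex_rep_system: "\<exists>\<RR>. rep_system \<RR>"
proof -
  define c :: "nat rel \<Rightarrow> nat rel" where "c P = (SOME P'. fin_poset P' \<and> poset_iso P P')" for P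
  have c: "fin_poset (c P) \<and> poset_iso P (c P)" if "fin_poset P" for P :: "nat rel"
    unfolding c_def by (rule someI[of _ P]) (simp add: that poset_iso_refl)
  have cong: "c P = c Q" if "poset_iso P Q" for P Q :: "nat rel"
  proof -
    have "poset_iso P T \<longleftrightarrow> poset_iso Q T" for T :: "nat rel"
      using that poset_iso_sym poset_iso_trans by blast
    then show ?thesis unfolding c_def by simp
  qed
  have "\<exists>!P'. P' \<in> c ` Collect fin_poset \<and> poset_iso P P'" if P: "fin_poset P" for P :: "nat rel"
  proof (rule ex1I[of _ "c P"])
    show "c P \<in> c ` Collect fin_poset \<and> poset_iso P (c P)" using c P by simp
  next
    fix P' assume "P' \<in> c ` Collect fin_poset \<and> poset_iso P P'"
    then obtain Q where Q: "fin_poset Q" "P' = c Q" "poset_iso P (c Q)" by blast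
    then have "c P = c (c Q)" "c Q = c (c Q)" using c cong by blast+
    with Q show "P' = c P" by simp
  qed
  then have "rep_system (c ` Collect fin_poset)"
    unfolding rep_system_def using c by auto
  then show ?thesis by blast
qed

lemma rep_system_covers:
  fixes P :: "'a rel"
  assumes "rep_system \<RR>" and P: "fin_poset P"
  shows "\<exists>P' \<in> \<RR>. poset_iso P P'"
proof -
  obtain f :: "'a \<Rightarrow> nat" where f: "inj_on f (Field P)"
    using P finite_imp_inj_to_nat_seg unfolding fin_poset_def by metis
  define N where "N = {(f x, f y) |x y. (x, y) \<in> P}"
  have F: "Field N = f ` Field P"
    unfolding N_def Field_def image_Un Domain_fst Range_snd by force
  have mem: "(f x, f y) \<in> N \<longleftrightarrow> (x, y) \<in> P" if xy: "x \<in> Field P" "y \<in> Field P" for x y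
  proof
    assume "(f x, f y) \<in> N"
    then obtain u v where uv: "(u, v) \<in> P" "f x = f u" "f y = f v"
      unfolding N_def by blast
    moreover have "u \<in> Field P" "v \<in> Field P" using uv(1) by (auto intro: FieldI1 FieldI2)
    ultimately show "(x, y) \<in> P" using f xy by (simp add: inj_on_eq_iff)
  next
    assume "(x, y) \<in> P"
    then show "(f x, f y) \<in> N" unfolding N_def by blast
  qed
  have img: "\<exists>x \<in> Field P. \<exists>y \<in> Field P. a = f x \<and> b = f y" if "(a, b) \<in> N" for a b
    using FieldI1[OF that] FieldI2[OF that] unfolding F by blast
  have po: "Refl P" "trans P" "antisym P"
    using P unfolding fin_poset_def order_on_defs by auto
  have "N \<subseteq> Field N \<times> Field N" by (auto intro: FieldI1 FieldI2)
  moreover have "Refl N"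
    using po(1) mem unfolding refl_on_def F by auto
  moreover have "trans N"
  proof (rule transI)
    fix a b d assume ab: "(a, b) \<in> N" "(b, d) \<in> N"
    obtain x y where xy: "x \<in> Field P" "y \<in> Field P" "a = f x" "b = f y"
      using img[OF ab(1)] by blast
    obtain z where z: "z \<in> Field P" "d = f z"
      using img[OF ab(2)] by blast
    have "(x, y) \<in> P" "(y, z) \<in> P" using ab xy z mem by auto
    then have "(x, z) \<in> P" using po(2) by (rule transD[rotated])
    then show "(a, d) \<in> N" using xy z mem by simp
  qed
  moreover have "antisym N"
  proof (rule antisymI)
    fix a b assume ab: "(a, b) \<in> N" "(b, a) \<in> N"
    obtain x y where xy: "x \<in> Field P" "y \<in> Field P" "a = f x" "b = f y"
      using img[OF ab(1)] by blast
    have "(x, y) \<in> P" "(y, x) \<in> P" using ab xy mem by auto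
    then have "x = y" using po(3) by (rule antisymD[rotated])
    then show "a = b" using xy by simp
  qed
  ultimately have N: "fin_poset N"
    using P F unfolding fin_poset_def order_on_defs by simp
  have "poset_iso P N"
    unfolding poset_iso_def using f F mem by (auto simp: bij_betw_def)
  moreover obtain P' where "P' \<in> \<RR>" "poset_iso N P'"
    using assms(1) N unfolding rep_system_def by blast
  ultimately show ?thesis using poset_iso_trans by blast
qed

lemma Field_direct_sum [simp]: "Field (A \<oplus> B) = Field A \<union> Field B"
  by (auto simp: direct_sum_def)

lemma fin_poset_direct_sum:
  assumes "fin_poset A" "fin_poset B" "Field A \<inter> Field B = {}"
  shows "fin_poset (A \<oplus> B)"
proof -
  have d: "x \<in> Field A \<Longrightarrow> x \<in> Field B \<Longrightarrow> False" for x
    using assms(3) by blast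
  have A: "refl_on (Field A) A" "trans A" "antisym A" "A \<subseteq> Field A \<times> Field A" "finite (Field A)" "Field A \<noteq> {}"
    and B: "refl_on (Field B) B" "trans B" "antisym B" "B \<subseteq> Field B \<times> Field B" "finite (Field B)"
    using assms(1,2) unfolding fin_poset_def order_on_defs by auto
  have "trans (A \<union> B)"
  proof (rule transI)
    fix x y z assume "(x, y) \<in> A \<union> B" "(y, z) \<in> A \<union> B"
    then consider "(x, y) \<in> A" "(y, z) \<in> A" | "(x, y) \<in> B" "(y, z) \<in> B"
      using d[of y] by (auto intro: FieldI1 FieldI2)
    then show "(x, z) \<in> A \<union> B"
      by cases (use A(2) B(2) in \<open>auto dest: transD\<close>)
  qed
  moreover have "antisym (A \<union> B)"
  proof (rule antisymI)
    fix x y assume "(x, y) \<in> A \<union> B" "(y, x) \<in> A \<union> B"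
    then consider "(x, y) \<in> A" "(y, x) \<in> A" | "(x, y) \<in> B" "(y, x) \<in> B"
      using d[of y] by (auto intro: FieldI1 FieldI2)
    then show "x = y"
      by cases (use A(3) B(3) in \<open>auto dest: antisymD\<close>)
  qed
  moreover have "Refl (A \<union> B)"
    using A(1) B(1) unfolding refl_on_def by auto
  moreover have "A \<union> B \<subseteq> Field (A \<union> B) \<times> Field (A \<union> B)"
    using A(4) B(4) by auto
  ultimately show ?thesis
    unfolding fin_poset_def order_on_defs direct_sum_def using A(5,6) B(5) by simp
qed

end

theory Submission
  imports Defs
begin

text \<open>
  A strong scheme exists iff \<open>|H(P, R)| \<le> |H(P, S)|\<close> for all \<open>P\<close>, and a strong G-scheme exists iff this
  holds after splitting both sides according to the prescribed sets \<open>G\<^sub>\<xi>(x)\<close>. These counts are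
  additive in the target on connected \<open>P\<close>, so that \<open>Q\<close> cancels there, and multiplicative when \<open>P\<close> is
  split into unions of connected components. Both parts of the theorem are instances of one
  argument, for an invariant \<open>\<sigma> P \<xi> x\<close> compatible with embeddings of unions of components: the
  constant one gives (i), and \<open>G\<close> gives (ii).
\<close>

section \<open>Unions of connected components, and embeddings onto them\<close>

definition order_closed :: "'a rel \<Rightarrow> 'a set \<Rightarrow> bool" where
  "order_closed P C \<longleftrightarrow> C \<subseteq> Field P \<and> (\<forall>(x, y) \<in> P. x \<in> C \<longleftrightarrow> y \<in> C)"

text \<open>Isomorphisms onto a union of connected components. One notion covers both transports
  needed later: isomorphisms onto a representative, and inclusions of pieces of a disconnected
  poset.\<close>

definition closed_embedding :: "('a \<Rightarrow> 'b) \<Rightarrow> 'a rel \<Rightarrow> 'b rel \<Rightarrow> bool" where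
  "closed_embedding f P P' \<longleftrightarrow> inj_on f (Field P) \<and> order_closed P' (f ` Field P) \<and>
    (\<forall>x \<in> Field P. \<forall>y \<in> Field P. (x, y) \<in> P \<longleftrightarrow> (f x, f y) \<in> P')"

lemma order_closed_Diff: "order_closed P C \<Longrightarrow> order_closed P (Field P - C)"
  unfolding order_closed_def by (auto intro: FieldI1 FieldI2)

lemma fin_poset_Restr:
  assumes "fin_poset P" "C \<subseteq> Field P" "C \<noteq> {}"
  shows "fin_poset (Restr P C)" "Field (Restr P C) = C"
proof -
  have "Refl P" using assms(1) unfolding fin_poset_def order_on_defs by auto
  then show F: "Field (Restr P C) = C"
    using assms(2) unfolding refl_on_def Field_def by blast
  have "Partial_order (Restr P C)"
    using assms(1) Partial_order_Restr unfolding fin_poset_def by blast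
  then show "fin_poset (Restr P C)"
    using assms F unfolding fin_poset_def by (metis finite_subset)
qed

lemma closed_embedding_Restr:
  assumes "fin_poset P" "order_closed P C" "C \<noteq> {}"
  shows "closed_embedding id (Restr P C) P"
  using assms fin_poset_Restr[OF assms(1) _ assms(3)]
  unfolding closed_embedding_def order_closed_def by auto

text \<open>A zigzag that starts in the image of \<open>f\<close> never leaves it, since the image
  is closed under comparability. Hence zigzags inside a level set lift step by step along
  \<open>f\<close>.\<close>

lemma G_closed_embedding:
  assumes f: "closed_embedding f P P'" and x: "x \<in> Field P"
  shows "f ` G P (restrict (\<xi> \<circ> f) (Field P)) x = G P' \<xi> (f x)"
proof -
  define A where "A = {y \<in> Field P. \<xi> (f y) = \<xi> (f x)}"
  define A' where "A' = {y \<in> Field P'. \<xi> y = \<xi> (f x)}"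
  define E where "E = {(u, v). u \<in> A \<and> v \<in> A \<and> u \<noteq> v \<and> ((u, v) \<in> P \<or> (v, u) \<in> P)}"
  define E' where "E' = {(u, v). u \<in> A' \<and> v \<in> A' \<and> u \<noteq> v \<and> ((u, v) \<in> P' \<or> (v, u) \<in> P')}"
  have inj: "inj_on f (Field P)" and sub: "f ` Field P \<subseteq> Field P'"
    and cl: "\<And>u v. (u, v) \<in> P' \<Longrightarrow> u \<in> f ` Field P \<longleftrightarrow> v \<in> f ` Field P"
    and ord: "\<And>u v. u \<in> Field P \<Longrightarrow> v \<in> Field P \<Longrightarrow> (u, v) \<in> P \<longleftrightarrow> (f u, f v) \<in> P'"
    using f unfolding closed_embedding_def order_closed_def by blast+
  have step: "(f u, f v) \<in> E'" if "(u, v) \<in> E" for u v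
    using that inj sub ord unfolding E_def E'_def A_def A'_def by (auto dest: inj_onD)
  have fwd: "(f x, f y) \<in> E'\<^sup>*" if "(x, y) \<in> E\<^sup>*" for y
    using that by induct (auto intro: rtrancl_into_rtrancl step)
  have bwd: "\<exists>y \<in> Field P. z = f y \<and> (x, y) \<in> E\<^sup>*" if "(f x, z) \<in> E'\<^sup>*" for z
    using that
  proof induct
    case base
    show ?case using x by blast
  next
    case (step z w)
    then obtain y where y: "y \<in> Field P" "z = f y" "(x, y) \<in> E\<^sup>*" by blast
    have zw: "z \<in> A'" "w \<in> A'" "z \<noteq> w" "(z, w) \<in> P' \<or> (w, z) \<in> P'"
      using step(2) unfolding E'_def by auto
    \<comment> \<open>Closedness of the image pulls the next vertex of the zigzag back to
      \<open>P\<close>.\<close>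
    then obtain v where v: "v \<in> Field P" "w = f v" using cl y by blast
    have "(y, v) \<in> E" using zw y v ord unfolding E_def A_def A'_def by auto
    with y v show ?case by (blast intro: rtrancl_into_rtrancl)
  qed
  have "G P (restrict (\<xi> \<circ> f) (Field P)) x = {y. (x, y) \<in> E\<^sup>*}"
  proof -
    have "{y \<in> Field P. restrict (\<xi> \<circ> f) (Field P) y = restrict (\<xi> \<circ> f) (Field P) x} = A"
      using x unfolding A_def by auto
    then show ?thesis unfolding G_def gamma_def E_def by simp
  qed
  moreover have "G P' \<xi> (f x) = {y. (f x, y) \<in> E'\<^sup>*}"
    unfolding G_def gamma_def E'_def A'_def by simp
  ultimately show ?thesis using fwd bwd by blast
qed

lemma G_subset_Field:
  assumes "x \<in> Field P"
  shows "G P \<xi> x \<subseteq> Field P"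
proof -
  have "y \<in> Field P" if "y \<in> G P \<xi> x" for y
    using that unfolding G_def gamma_def mem_Collect_eq by induct (use assms in auto)
  then show ?thesis by blast
qed

section \<open>Homomorphisms, their restrictions, and direct sums as targets\<close>

lemma Hom_iff:
  "\<xi> \<in> Hom P R \<longleftrightarrow> \<xi> \<in> extensional (Field P) \<and> (\<forall>x \<in> Field P. \<xi> x \<in> Field R) \<and>
    (\<forall>x \<in> Field P. \<forall>y \<in> Field P. (x, y) \<in> P \<longrightarrow> (\<xi> x, \<xi> y) \<in> R)"
  unfolding Hom_def monotone_on_def PiE_def Pi_def by auto

lemma finite_Hom: "fin_poset P \<Longrightarrow> fin_poset R \<Longrightarrow> finite (Hom P R)"
  using finite_PiE[of "Field P" "\<lambda>_. Field R"] unfolding Hom_def fin_poset_def by simp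

lemma Hom_restrict_comp:
  assumes "\<xi> \<in> Hom P' R" "closed_embedding f P P'"
  shows "restrict (\<xi> \<circ> f) (Field P) \<in> Hom P R"
  using assms unfolding Hom_iff closed_embedding_def order_closed_def by (auto simp: image_subset_iff)

text \<open>No comparability links \<open>Q\<close> with \<open>R\<close>, so the preimage of
  \<open>Field Q\<close> is order-closed. The hypothesis \<open>conn\<close> expresses connectedness
  of \<open>P\<close> and forces this preimage to be empty or everything.\<close>

lemma Hom_direct_sum:
  assumes P: "fin_poset P" and conn: "\<And>C. order_closed P C \<Longrightarrow> C = {} \<or> C = Field P"
    and disj: "Field Q \<inter> Field R = {}"
  shows "Hom P (Q \<oplus> R) = Hom P Q \<union> Hom P R"
proof (intro subset_antisym subsetI)
  fix \<xi> assume \<xi>: "\<xi> \<in> Hom P (Q \<oplus> R)"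
  have edge: "(\<xi> x, \<xi> y) \<in> Q \<or> (\<xi> x, \<xi> y) \<in> R" if "(x, y) \<in> P" for x y
    using \<xi> FieldI1[OF that] FieldI2[OF that] that unfolding Hom_iff direct_sum_def by auto
  have "\<xi> x \<in> Field Q \<longleftrightarrow> \<xi> y \<in> Field Q" if "(x, y) \<in> P" for x y
    using edge[OF that] disj by (auto dest: FieldI1 FieldI2)
  then have "order_closed P {x \<in> Field P. \<xi> x \<in> Field Q}"
    unfolding order_closed_def by (auto intro: FieldI1 FieldI2)
  then consider "{x \<in> Field P. \<xi> x \<in> Field Q} = {}" | "{x \<in> Field P. \<xi> x \<in> Field Q} = Field P"
    using conn by blast
  then show "\<xi> \<in> Hom P Q \<union> Hom P R"
  proof cases
    case 1
    then have "\<xi> \<in> Hom P R"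
      using \<xi> edge unfolding Hom_iff Field_direct_sum by (blast intro: FieldI1 FieldI2)
    then show ?thesis by blast
  next
    case 2
    then have "\<xi> \<in> Hom P Q"
      using \<xi> edge disj unfolding Hom_iff Field_direct_sum by (blast intro: FieldI1 FieldI2)
    then show ?thesis by blast
  qed
next
  fix \<xi> assume "\<xi> \<in> Hom P Q \<union> Hom P R"
  then show "\<xi> \<in> Hom P (Q \<oplus> R)"
    by (auto simp: Hom_iff) (auto simp: direct_sum_def)
qed

lemma Hom_disjoint:
  assumes "Field P \<noteq> {}" "Field Q \<inter> Field R = {}"
  shows "Hom P Q \<inter> Hom P R = {}"
  using assms by (fastforce simp: Hom_iff)

section \<open>Homomorphism counts refined by an invariant\<close>

locale hom_invariant =
  fixes \<sigma> :: "nat rel \<Rightarrow> (nat \<Rightarrow> 'a) \<Rightarrow> nat \<Rightarrow> nat set"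
  assumes closed_embedding: "\<And>f P P' \<xi> x. closed_embedding f P P' \<Longrightarrow> x \<in> Field P \<Longrightarrow>
      f ` \<sigma> P (restrict (\<xi> \<circ> f) (Field P)) x = \<sigma> P' \<xi> (f x)"
    and subset_Field: "\<And>P \<xi> x. x \<in> Field P \<Longrightarrow> \<sigma> P \<xi> x \<subseteq> Field P"
begin

text \<open>The fibres of the invariant. Only the values of \<open>g\<close> on
  \<open>Field P\<close> matter, and the fibres partition \<open>Hom P R\<close>.\<close>

definition Homs :: "nat rel \<Rightarrow> (nat \<Rightarrow> nat set) \<Rightarrow> 'a rel \<Rightarrow> (nat \<Rightarrow> 'a) set" where
  "Homs P g R = {\<xi> \<in> Hom P R. \<forall>x \<in> Field P. \<sigma> P \<xi> x = g x}"

text \<open>Common form of the two relations of the theorem. Both targets share one element type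
  because the locale fixes \<open>\<sigma>\<close> at a single type.\<close>

definition strong_le :: "nat rel set \<Rightarrow> 'a rel \<Rightarrow> 'a rel \<Rightarrow> bool" where
  "strong_le \<RR> R S \<longleftrightarrow> (\<exists>\<rho>. strong_scheme \<RR> R S \<rho> \<and>
    (\<forall>P \<in> \<RR>. \<forall>\<xi> \<in> Hom P R. \<forall>x \<in> Field P. \<sigma> P (\<rho> P \<xi>) x = \<sigma> P \<xi> x))"

lemma finite_Homs: "fin_poset P \<Longrightarrow> fin_poset R \<Longrightarrow> finite (Homs P g R)"
  unfolding Homs_def by (simp add: finite_Hom)

text \<open>An invariant-preserving injection maps each fibre injectively into the finite fibre with
  the same label.\<close>

lemma strong_le_imp_card_le:
  assumes "strong_le \<RR> R S" "P \<in> \<RR>" "fin_poset P" "fin_poset S"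
  shows "card (Homs P g R) \<le> card (Homs P g S)"
proof -
  obtain \<rho> where "\<rho> P \<in> Hom P R \<rightarrow> Hom P S" and inj: "inj_on (\<rho> P) (Hom P R)"
    and "\<forall>\<xi> \<in> Hom P R. \<forall>x \<in> Field P. \<sigma> P (\<rho> P \<xi>) x = \<sigma> P \<xi> x"
    using assms(1,2) unfolding strong_le_def strong_scheme_def hom_scheme_def by blast
  then have "\<rho> P ` Homs P g R \<subseteq> Homs P g S" unfolding Homs_def by auto
  moreover have "inj_on (\<rho> P) (Homs P g R)"
    using inj unfolding Homs_def by (rule inj_on_subset) auto
  ultimately show ?thesis using card_inj_on_le[OF _ _ finite_Homs[OF assms(3,4)]] by blast
qed

text \<open>Choose an injection on every fibre and glue. Images of different fibres cannot collide,
  since the label survives in the image.\<close>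

lemma card_le_imp_strong_le:
  assumes fin: "\<And>P. P \<in> \<RR> \<Longrightarrow> fin_poset P" "fin_poset R" "fin_poset S"
    and le: "\<And>P g. P \<in> \<RR> \<Longrightarrow> card (Homs P g R) \<le> card (Homs P g S)"
  shows "strong_le \<RR> R S"
proof -
  have "\<exists>h. h ` Homs P g R \<subseteq> Homs P g S \<and> inj_on h (Homs P g R)" if "P \<in> \<RR>" for P g
    by (rule card_le_inj[OF finite_Homs finite_Homs le]) (use fin that in auto)
  then obtain h where h: "\<And>P g. P \<in> \<RR> \<Longrightarrow> h P g ` Homs P g R \<subseteq> Homs P g S"
    and inj: "\<And>P g. P \<in> \<RR> \<Longrightarrow> inj_on (h P g) (Homs P g R)"
    by metis
  \<comment> \<open>The label of the fibre containing \<open>\<xi>\<close>. Restricting it makes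
    labels that agree on \<open>Field P\<close> equal as functions, so that \<open>h\<close> is
    applied with the same label.\<close>
  define s where "s P \<xi> = restrict (\<sigma> P \<xi>) (Field P)" for P \<xi>
  define \<rho> where "\<rho> P \<xi> = h P (s P \<xi>) \<xi>" for P \<xi>
  have mem: "\<xi> \<in> Homs P (s P \<xi>) R" if "\<xi> \<in> Hom P R" for P \<xi>
    using that unfolding Homs_def s_def by auto
  have \<rho>: "\<rho> P \<xi> \<in> Homs P (s P \<xi>) S" if "P \<in> \<RR>" "\<xi> \<in> Hom P R" for P \<xi>
    using h[OF that(1)] mem[OF that(2)] unfolding \<rho>_def by blast
  have pres: "\<sigma> P (\<rho> P \<xi>) x = \<sigma> P \<xi> x" if "P \<in> \<RR>" "\<xi> \<in> Hom P R" "x \<in> Field P" for P \<xi> x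
    using \<rho>[OF that(1,2)] that(3) unfolding Homs_def s_def by auto
  have "inj_on (\<rho> P) (Hom P R)" if P: "P \<in> \<RR>" for P
  proof (rule inj_onI)
    fix \<xi> \<eta> assume *: "\<xi> \<in> Hom P R" "\<eta> \<in> Hom P R" "\<rho> P \<xi> = \<rho> P \<eta>"
    have "s P \<xi> = s P \<eta>"
      using pres[OF P *(1)] pres[OF P *(2)] *(3) unfolding s_def by (intro restrict_ext) simp
    then show "\<xi> = \<eta>"
      using inj_onD[OF inj[OF P, of "s P \<xi>"]] mem[OF *(1)] mem[OF *(2)] *(3)
      unfolding \<rho>_def by simp
  qed
  moreover have "\<rho> P \<in> Hom P R \<rightarrow> Hom P S" if "P \<in> \<RR>" for P
    using \<rho>[OF that] unfolding Homs_def by auto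
  ultimately show ?thesis
    using pres unfolding strong_le_def strong_scheme_def hom_scheme_def by blast
qed

text \<open>The label is transported along the isomorphism. A single \<open>g'\<close> serves every
  target \<open>R\<close>, so an inequality between two targets can be moved from \<open>P'\<close>
  to \<open>P\<close>.\<close>

lemma card_Homs_iso:
  assumes "poset_iso P P'" and g: "\<And>x. x \<in> Field P \<Longrightarrow> g x \<subseteq> Field P"
  obtains g' where "\<And>R. card (Homs P g R) = card (Homs P' g' R)"
proof -
  obtain f where f: "bij_betw f (Field P) (Field P')"
    and ord: "\<And>x y. x \<in> Field P \<Longrightarrow> y \<in> Field P \<Longrightarrow> (x, y) \<in> P \<longleftrightarrow> (f x, f y) \<in> P'"
    using assms(1) unfolding poset_iso_def by blast
  have emb: "closed_embedding f P P'"
    using f ord unfolding closed_embedding_def order_closed_def bij_betw_def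
    by (auto intro: FieldI1 FieldI2)
  define i where "i = inv_into (Field P) f"
  have i: "\<And>x. x \<in> Field P \<Longrightarrow> i (f x) = x" "\<And>y. y \<in> Field P' \<Longrightarrow> f (i y) = y"
    and ib: "\<And>y. y \<in> Field P' \<Longrightarrow> i y \<in> Field P" and fb: "\<And>x. x \<in> Field P \<Longrightarrow> f x \<in> Field P'"
    using f bij_betw_inv_into_left bij_betw_inv_into_right bij_betwE[OF bij_betw_inv_into[OF f]]
      bij_betwE[OF f] unfolding i_def by auto
  have emb_i: "closed_embedding i P' P"
    using bij_betw_inv_into[OF f] ord i(2) ib
    unfolding closed_embedding_def order_closed_def bij_betw_def i_def
    by (auto intro: FieldI1 FieldI2)
  define g' where "g' y = f ` g (i y)" for y
  define F where "F \<xi> = restrict (\<xi> \<circ> f) (Field P)" for \<xi> :: "nat \<Rightarrow> 'a"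
  define I where "I \<xi> = restrict (\<xi> \<circ> i) (Field P')" for \<xi> :: "nat \<Rightarrow> 'a"
  have IF: "I (F \<xi>) = \<xi>" if "\<xi> \<in> Hom P' R" for \<xi> R
    using that i ib unfolding F_def I_def Hom_iff by (auto simp: fun_eq_iff extensional_def)
  have FI: "F (I \<xi>) = \<xi>" if "\<xi> \<in> Hom P R" for \<xi> R
    using that i fb unfolding F_def I_def Hom_iff by (auto simp: fun_eq_iff extensional_def)
  have \<sigma>: "(\<forall>y \<in> Field P'. \<sigma> P' \<xi> y = g' y) \<longleftrightarrow> (\<forall>x \<in> Field P. \<sigma> P (F \<xi>) x = g x)" for \<xi>
  proof -
    \<comment> \<open>Injectivity of \<open>f\<close> is known on \<open>Field P\<close> only. Both
      sets compared lie there, so equal images mean equal sets.\<close>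
    have "\<sigma> P' \<xi> (f x) = g' (f x) \<longleftrightarrow> \<sigma> P (F \<xi>) x = g x" if x: "x \<in> Field P" for x
      using closed_embedding[OF emb x, of \<xi>] i(1)[OF x] subset_Field[OF x] g[OF x]
        inj_on_image_eq_iff[OF bij_betw_imp_inj_on[OF f]]
      unfolding g'_def F_def by metis
    then have "(\<forall>y \<in> f ` Field P. \<sigma> P' \<xi> y = g' y) \<longleftrightarrow> (\<forall>x \<in> Field P. \<sigma> P (F \<xi>) x = g x)"
      by auto
    then show ?thesis unfolding bij_betw_imp_surj_on[OF f] .
  qed
  have "bij_betw F (Homs P' g' R) (Homs P g R)" for R
  proof (rule bij_betw_byWitness[of _ I])
    show "F ` Homs P' g' R \<subseteq> Homs P g R"
      using Hom_restrict_comp[OF _ emb] \<sigma> unfolding Homs_def F_def by blast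
    have "I \<xi> \<in> Homs P' g' R" if "\<xi> \<in> Homs P g R" for \<xi>
      using that Hom_restrict_comp[OF _ emb_i, of \<xi> R] \<sigma>[of "I \<xi>"] FI[of \<xi> R]
      unfolding Homs_def I_def by simp
    then show "I ` Homs P g R \<subseteq> Homs P' g' R" by blast
    show "\<forall>\<xi> \<in> Homs P' g' R. I (F \<xi>) = \<xi>" using IF unfolding Homs_def by blast
    show "\<forall>\<xi> \<in> Homs P g R. F (I \<xi>) = \<xi>" using FI unfolding Homs_def by blast
  qed
  then have "card (Homs P g R) = card (Homs P' g' R)" for R
    by (rule bij_betw_same_card[symmetric])
  then show ?thesis by (rule that)
qed

text \<open>Schemes are indexed by representatives, whereas the induction below passes to subposets
  that need not be representatives. Hence the bound is extended to all finite posets on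
  \<open>nat\<close>.\<close>

lemma strong_le_imp_card_le_all:
  assumes \<RR>: "rep_system \<RR>" and le: "strong_le \<RR> R S" and fin: "fin_poset P" "fin_poset S"
  shows "card (Homs P g R) \<le> card (Homs P g S)"
proof (cases "\<forall>x \<in> Field P. g x \<subseteq> Field P")
  case True
  obtain P' where P': "P' \<in> \<RR>" "poset_iso P P'"
    using rep_system_covers[OF \<RR> fin(1)] by blast
  obtain g' where "\<And>R. card (Homs P g R) = card (Homs P' g' R)"
    using card_Homs_iso[OF P'(2)] True by blast
  then show ?thesis
    using strong_le_imp_card_le[OF le P'(1) _ fin(2)] P'(1) \<RR> unfolding rep_system_def by simp
next
  case False
  \<comment> \<open>A label with a value outside \<open>Field P\<close> is never attained.\<close>
  then have "Homs P g R = {}" using subset_Field unfolding Homs_def by blast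
  then show ?thesis by simp
qed

section \<open>Additivity, multiplicativity and cancellation of the counts\<close>

lemma card_Homs_direct_sum:
  assumes P: "fin_poset P" and conn: "\<And>C. order_closed P C \<Longrightarrow> C = {} \<or> C = Field P"
    and fin: "fin_poset Q" "fin_poset R" and disj: "Field Q \<inter> Field R = {}"
  shows "card (Homs P g (Q \<oplus> R)) = card (Homs P g Q) + card (Homs P g R)"
proof -
  \<comment> \<open>The invariant of a map does not depend on its codomain, so the decomposition of
    \<open>Hom\<close> passes to fibres.\<close>
  have "Homs P g (Q \<oplus> R) = Homs P g Q \<union> Homs P g R"
    using Hom_direct_sum[OF P conn disj] unfolding Homs_def by blast
  moreover have "Homs P g Q \<inter> Homs P g R = {}"
    using Hom_disjoint[OF _ disj, of P] P unfolding Homs_def fin_poset_def by blast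
  ultimately show ?thesis using card_Un_disjoint finite_Homs P fin by metis
qed

lemma \<sigma>_Restr:
  assumes "fin_poset P" "order_closed P C" "x \<in> C"
  shows "\<sigma> (Restr P C) (restrict \<xi> C) x = \<sigma> P \<xi> x"
proof -
  have C: "C \<noteq> {}" "Field (Restr P C) = C"
    using assms fin_poset_Restr(2)[OF assms(1)] unfolding order_closed_def by auto
  show ?thesis
    using closed_embedding[OF closed_embedding_Restr[OF assms(1,2) C(1)], of x \<xi>] C assms(3)
    by simp
qed

text \<open>There are no comparabilities between \<open>C\<close> and its complement, so
  homomorphisms on the two pieces combine freely. By \<open>\<sigma>_Restr\<close> the invariant is
  computed within each piece, so the fibre is a product as well.\<close>

lemma card_Homs_split:
  assumes P: "fin_poset P" and C: "order_closed P C" "C \<noteq> {}" "C \<noteq> Field P"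
  shows "card (Homs P g R) =
    card (Homs (Restr P C) g R) * card (Homs (Restr P (Field P - C)) g R)"
proof -
  define D where "D = Field P - C"
  have D: "order_closed P D" "D \<noteq> {}"
    using order_closed_Diff[OF C(1)] C(1,3) unfolding D_def order_closed_def by auto
  have sub: "C \<subseteq> Field P" "D \<subseteq> Field P" using C D unfolding order_closed_def by auto
  have cov: "Field P = C \<union> D" "C \<inter> D = {}" using sub unfolding D_def by auto
  have FC: "Field (Restr P C) = C" and FD: "Field (Restr P D) = D"
    using fin_poset_Restr(2)[OF P] sub C D by auto
  have split: "x \<in> C \<longleftrightarrow> y \<in> C" if "(x, y) \<in> P" for x y
    using that C(1) unfolding order_closed_def by auto
  \<comment> \<open>\<open>J\<close> glues a pair of maps; \<open>F\<close> cuts a map into its two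
    restrictions.\<close>
  define J where "J = (\<lambda>(\<alpha>, \<beta>) x. if x \<in> C then \<alpha> x else \<beta> x :: 'a)"
  define F where "F \<xi> = (restrict \<xi> C, restrict \<xi> D)" for \<xi> :: "nat \<Rightarrow> 'a"
  have JF: "J (F \<xi>) = \<xi>" if "\<xi> \<in> Hom P R" for \<xi>
    using that cov unfolding J_def F_def Hom_iff by (auto simp: fun_eq_iff extensional_def)
  have FJ: "F (J (\<alpha>, \<beta>)) = (\<alpha>, \<beta>)"
    if "\<alpha> \<in> Hom (Restr P C) R" "\<beta> \<in> Hom (Restr P D) R" for \<alpha> \<beta>
    using that cov(2) unfolding J_def F_def Hom_iff FC FD
    by (auto simp: fun_eq_iff extensional_def)
  have hom: "\<xi> \<in> Hom P R \<longleftrightarrow> \<xi> \<in> extensional (Field P) \<and>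
      restrict \<xi> C \<in> Hom (Restr P C) R \<and> restrict \<xi> D \<in> Hom (Restr P D) R" for \<xi>
    unfolding Hom_iff FC FD using cov by (auto dest: split)
  have homs: "\<xi> \<in> Homs P g R \<longleftrightarrow> \<xi> \<in> extensional (Field P) \<and>
      F \<xi> \<in> Homs (Restr P C) g R \<times> Homs (Restr P D) g R" for \<xi>
    unfolding Homs_def F_def mem_Collect_eq mem_Times_iff fst_conv snd_conv FC FD hom
    using \<sigma>_Restr[OF P C(1)] \<sigma>_Restr[OF P D(1)] cov(1) by auto
  have "bij_betw F (Homs P g R) (Homs (Restr P C) g R \<times> Homs (Restr P D) g R)"
  proof (rule bij_betw_byWitness[of _ J])
    show "\<forall>\<xi> \<in> Homs P g R. J (F \<xi>) = \<xi>" using JF unfolding Homs_def by blast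
    show FJ': "\<forall>p \<in> Homs (Restr P C) g R \<times> Homs (Restr P D) g R. F (J p) = p"
      using FJ unfolding Homs_def by blast
    show "F ` Homs P g R \<subseteq> Homs (Restr P C) g R \<times> Homs (Restr P D) g R"
      using homs by blast
    have "J p \<in> extensional (Field P)"
      if "p \<in> Homs (Restr P C) g R \<times> Homs (Restr P D) g R" for p
      using that cov unfolding J_def Homs_def Hom_iff FC FD by (auto simp: extensional_def)
    then show "J ` (Homs (Restr P C) g R \<times> Homs (Restr P D) g R) \<subseteq> Homs P g R"
      using homs FJ' by auto
  qed
  then show ?thesis
    using bij_betw_same_card card_cartesian_product unfolding D_def by metis
qed

text \<open>Induction on the size of \<open>P\<close>. For connected \<open>P\<close> the count into
  \<open>Q\<close> is subtracted from both sides. Otherwise \<open>P\<close> splits into two smaller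
  pieces, and their inequalities for \<open>R\<close> and \<open>S\<close> are multiplied.\<close>

lemma card_Homs_cancel:
  assumes fin: "fin_poset Q" "fin_poset R" "fin_poset S"
    and disj: "Field Q \<inter> Field R = {}" "Field Q \<inter> Field S = {}"
    and le: "\<And>P g. fin_poset P \<Longrightarrow> card (Homs P g (Q \<oplus> R)) \<le> card (Homs P g (Q \<oplus> S))"
    and "fin_poset P"
  shows "card (Homs P g R) \<le> card (Homs P g S)"
  using \<open>fin_poset P\<close>
proof (induction "card (Field P)" arbitrary: P rule: less_induct)
  case less
  note P = less.prems
  show ?case
  proof (cases "\<exists>C. order_closed P C \<and> C \<noteq> {} \<and> C \<noteq> Field P")
    case True
    then obtain C where C: "order_closed P C" "C \<noteq> {}" "C \<noteq> Field P" by blast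
    have IH: "card (Homs (Restr P D) g R) \<le> card (Homs (Restr P D) g S)"
      if "D \<subset> Field P" "D \<noteq> {}" for D
    proof (rule less.hyps)
      show "fin_poset (Restr P D)" using fin_poset_Restr[OF P] that by blast
      have "Field (Restr P D) = D" using fin_poset_Restr[OF P] that by blast
      then show "card (Field (Restr P D)) < card (Field P)"
        using psubset_card_mono[OF _ that(1)] P unfolding fin_poset_def by simp
    qed
    \<comment> \<open>Both pieces are proper and nonempty, as the induction hypothesis
      requires.\<close>
    have "C \<subset> Field P" "Field P - C \<subset> Field P" "Field P - C \<noteq> {}"
      using C unfolding order_closed_def by auto
    then show ?thesis
      unfolding card_Homs_split[OF P C] using IH C(2) by (simp add: mult_le_mono)
  next
    case False
    then have conn: "\<And>C. order_closed P C \<Longrightarrow> C = {} \<or> C = Field P" by blast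
    show ?thesis
      using le[OF P, of g] card_Homs_direct_sum[OF P conn fin(1,2) disj(1)]
        card_Homs_direct_sum[OF P conn fin(1,3) disj(2)] by simp
  qed
qed

lemma strong_le_cancel:
  assumes \<RR>: "rep_system \<RR>" and fin: "fin_poset Q" "fin_poset R" "fin_poset S"
    and disj: "Field Q \<inter> Field R = {}" "Field Q \<inter> Field S = {}"
    and le: "strong_le \<RR> (Q \<oplus> R) (Q \<oplus> S)"
  shows "strong_le \<RR> R S"
proof (rule card_le_imp_strong_le)
  fix P g assume "P \<in> \<RR>"
  then have P: "fin_poset P" using \<RR> unfolding rep_system_def by blast
  show "card (Homs P g R) \<le> card (Homs P g S)"
  proof (rule card_Homs_cancel[OF fin disj _ P])
    show "card (Homs P g (Q \<oplus> R)) \<le> card (Homs P g (Q \<oplus> S))" if "fin_poset P" for P g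
      using strong_le_imp_card_le_all[OF \<RR> le that fin_poset_direct_sum[OF fin(1,3) disj(2)]] .
  qed
qed (use \<RR> fin in \<open>auto simp: rep_system_def\<close>)

end

section \<open>The two instances of the invariant\<close>

interpretation trivial: hom_invariant "\<lambda>_ _ _. {}"
  by standard auto

interpretation G: hom_invariant G
  by standard (erule (1) G_closed_embedding, erule G_subset_Field)

theorem theorem3:
  fixes \<RR> :: "nat rel set" and Q R S :: "'a rel"
  assumes "rep_system \<RR>"
    and "fin_poset Q" and "fin_poset R" and "fin_poset S"
    and "Field Q \<inter> Field R = {}" and "Field Q \<inter> Field S = {}"
  shows "(hom_le \<RR> (Q \<oplus> R) (Q \<oplus> S) \<longrightarrow> hom_le \<RR> R S) \<and>
         (hom_le_G \<RR> (Q \<oplus> R) (Q \<oplus> S) \<longrightarrow> hom_le_G \<RR> R S)"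
proof -
  \<comment> \<open>Here preservation of the invariant reads \<open>{} = {}\<close>.\<close>
  have "trivial.strong_le \<RR> A B \<longleftrightarrow> hom_le \<RR> A B" for A B :: "'a rel"
    unfolding trivial.strong_le_def hom_le_def by simp
  moreover have "G.strong_le \<RR> A B \<longleftrightarrow> hom_le_G \<RR> A B" for A B :: "'a rel"
    unfolding G.strong_le_def hom_le_G_def G_scheme_def strong_scheme_def by blast
  ultimately show ?thesis
    using trivial.strong_le_cancel[OF assms] G.strong_le_cancel[OF assms] by blast
qed

end
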